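(* Let $\gamma_{\min}=\min_{l\in\{0,1\}}\gamma_l$ and $\rho_{\max}=\max_{l\in\{0,1\}}\rho_l$, where $\gamma_l,\rho_l>0$ are constants with $$\gamma_l(B_lu,u)_{\Omega_h}\le(A_lu,u)_{\Omega_h}\le\rho_l(B_lu,u)_{\Omega_h}\quad\text{for all }u\in V_h^l,\ l=0,1,$$ and let $K_a$ be the constant of the stable splitting, i.e. $\|v^0\|_a^2+\|v^1\|_a^2\le K_a\|v^0+v^1\|_a^2$ for all $v^0\in V_h^0$, $v^1\in V_h^1$. Then the spectrum $\sigma(CA)$ of $CA$, where $C=B_0^{-1}Q_0+B_1^{-1}Q_1$, is real and $$\sigma(CA)\subset\Big[\frac{\gamma_{\min}}{K_a},\,2\rho_{\max}\Big].$$
   Context: Geometry and mesh. Let $d\in\{2,3\}$, $\Omega\subset\mathbb{R}^d$ an open connected Lipschitz domain, $\Gamma=\partial\Omega$ with outward unit normal $n_\Gamma$. Let $\Omega^\ast\supset\Omega$ be a polygonal (polyhedral) domain with a family $\{\mathcal{T}_h^\ast\}_{h>0}$ of shape regular simplicial triangulations; $h_T$, $h_F$ denote the diameters of a simplex $T$, a face $F$. Define $\mathcal{T}_h=\{T\in\mathcal{T}_h^\ast : \mathrm{meas}_{d-1}(T\cap\Omega)>0\}$, $\Omega_h=\bigcup_{T\in\mathcal{T}_h}T$, $\mathcal{T}_h^\Gamma=\{T\in\mathcal{T}_h: T\cap\Gamma\ne\emptyset\}$. Standing assumption ($\Gamma$ sufficiently resolved, $h$ sufficiently small): $\mathcal{T}_h^\Gamma=\{T\in\mathcal{T}_h: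 T\cap\partial\Omega_h\neq\emptyset\}$. Finite element spaces. For fixed $k\ge1$, $V_h=\{v_h\in C(\Omega_h): v_h|_T\in\mathcal{P}_k\ \forall T\in\mathcal{T}_h\}$ with nodal basis $\phi_i$ and nodes $\xi_i$, $1\le i\le N$, ordered so that $\xi_i\in\partial\Omega_h$ iff $i>N_0$. $V_h^0=\mathrm{span}\{\phi_i: i\le N_0\}$ and $V_h^1:=V_h^\Gamma=\mathrm{span}\{\phi_i: N_0+1\le i\le N\}$, so $V_h=V_h^0\oplus V_h^1$. Bilinear form. $(\cdot,\cdot)_\omega$ is the $L^2(\omega)$ scalar product; $(h^{-1}u,v)_\Gamma:=\sum_{T\in\mathcal{T}_h^\Gamma}h_T^{-1}(u,v)_{T\cap\Gamma}$. With fixed $\gamma,\beta>0$, $\mathcal{F}_g$ the set of faces $F$ of simplices $T\in\mathcal{T}_h^\Gamma$ with $F\not\subset\partial\Omega_h$, $[\![\cdot]\!]$ the jump across $F$, $\partial_n$ the derivative normal to $F$, $$a_h(u,v)=(\nabla u,\nabla v)_\Omega-(n_\Gamma\cdot\nabla u,v)_\Gamma-(u,n_\Gamma\cdot\nabla v)_\Gamma+\gamma(h^{-1}u,v)_\Gamma+\beta\sum_{\ell=1}^k\sum_{F\in\mathcal{F}_g}h_F^{2\ell-1}([\![\partial_n^\ell u]\!],[\![\partial_n^\ell v]\!])_F .$$ Standing assumption: $\gamma$ is sufficiently large, so that $a_h$ is symmetric positive definite on $V_h$; $\|v\|_a=a_h(v,v)^{1/2}$. Operators. $Q_l:V_h\to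 V_h^l$ is the $L^2(\Omega_h)$-orthogonal projection, $l=0,1$. $A:V_h\to V_h$ is defined by $(Au,v)_{\Omega_h}=a_h(u,v)$ for all $u,v\in V_h$; $A_l:V_h^l\to V_h^l$ by $(A_lu,v)_{\Omega_h}=a_h(u,v)$ for all $u,v\in V_h^l$. $B_l:V_h^l\to V_h^l$, $l=0,1$, are given operators that are symmetric positive definite with respect to $(\cdot,\cdot)_{\Omega_h}$. The additive subspace preconditioner is $C=B_0^{-1}Q_0+B_1^{-1}Q_1:V_h\to V_h$. *)

theory Defs
  imports "HOL-Analysis.Analysis"
begin

section \<open>Hausdorff measure\<close>

text \<open>The normalisation makes the \<open>s\<close>-dimensional Hausdorff measure agree with the usual
  \<open>s\<close>-dimensional surface measure. Coverings are restricted to bounded sets because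
  \<^const>\<open>diameter\<close> is meaningful only for those; the empty set contributes \<open>0\<close> as long as
  \<open>s \<ge> 1\<close>.\<close>

definition hausdorff_pre :: "nat \<Rightarrow> real \<Rightarrow> 'a::euclidean_space set \<Rightarrow> ennreal" where
  "hausdorff_pre s \<delta> A =
     (INF U\<in>{U::nat \<Rightarrow> 'a set. A \<subseteq> (\<Union>i. U i) \<and> (\<forall>i. bounded (U i) \<and> diameter (U i) \<le> \<delta>)}.
        \<Sum>i. ennreal (unit_ball_vol (real s) * (diameter (U i) / 2) ^ s))"

definition hausdorff_outer :: "nat \<Rightarrow> 'a::euclidean_space set \<Rightarrow> ennreal" where
  "hausdorff_outer s A = (SUP \<delta>\<in>{0<..}. hausdorff_pre s \<delta> A)"

definition hausdorff :: "nat \<Rightarrow> 'a::euclidean_space measure" where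
  "hausdorff s = measure_of UNIV (sets borel) (hausdorff_outer s)"

lemma hausdorff_pre_mono: "A \<subseteq> B \<Longrightarrow> hausdorff_pre s \<delta> A \<le> hausdorff_pre s \<delta> B"
  unfolding hausdorff_pre_def by (rule INF_superset_mono) auto

lemma hausdorff_pre_antimono:
  "\<delta>' \<le> \<delta> \<Longrightarrow> hausdorff_pre s \<delta> A \<le> hausdorff_pre s \<delta>' A"
  unfolding hausdorff_pre_def by (intro INF_superset_mono order_refl) (auto intro: order_trans)

lemma hausdorff_outer_mono: "A \<subseteq> B \<Longrightarrow> hausdorff_outer s A \<le> hausdorff_outer s B"
  unfolding hausdorff_outer_def by (rule SUP_mono) (use hausdorff_pre_mono in blast)

lemma hausdorff_pre_subadditive:
  "hausdorff_pre s \<delta> (\<Union>n. A n) \<le> (\<Sum>n. hausdorff_pre s \<delta> (A n))"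
proof (rule ennreal_le_epsilon)
  define f where "f = (\<lambda>U::'a set. ennreal (unit_ball_vol (real s) * (diameter U / 2) ^ s))"
  fix e :: real assume e: "0 < e" and fin: "(\<Sum>n. hausdorff_pre s \<delta> (A n)) < top"
  then have *: "hausdorff_pre s \<delta> (A n) < hausdorff_pre s \<delta> (A n) + e * (1/2)^Suc n" for n
    by (auto simp add: less_top dest!: ennreal_suminf_lessD)
  have "\<exists>U. A n \<subseteq> (\<Union>i. U i) \<and> (\<forall>i. bounded (U i) \<and> diameter (U i) \<le> \<delta>) \<and>
          (\<Sum>i. f (U i)) \<le> hausdorff_pre s \<delta> (A n) + e * (1/2)^Suc n" for n
    using *[of n] unfolding hausdorff_pre_def[of s \<delta> "A n"] INF_less_iff f_def
    by (auto intro!: less_imp_le)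
  then obtain B where B: "\<And>n. A n \<subseteq> (\<Union>i. B n i)"
      "\<And>n i. bounded (B n i)" "\<And>n i. diameter (B n i) \<le> \<delta>"
      and Ble: "\<And>n. (\<Sum>i. f (B n i)) \<le> hausdorff_pre s \<delta> (A n) + e * (1/2)^Suc n"
    by metis
  define C where "C = case_prod B \<circ> prod_decode"
  have "x \<in> (\<Union>i. C i)" if "x \<in> A n" for x n
  proof -
    obtain i where "x \<in> B n i" using B(1) \<open>x \<in> A n\<close> by blast
    then have "x \<in> C (prod_encode (n, i))" by (simp add: C_def)
    then show ?thesis by blast
  qed
  then have "(\<Union>n. A n) \<subseteq> (\<Union>i. C i)" by blast
  moreover have "\<forall>i. bounded (C i) \<and> diameter (C i) \<le> \<delta>"
    using B(2,3) by (simp add: C_def split_def)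
  ultimately have "hausdorff_pre s \<delta> (\<Union>n. A n) \<le> (\<Sum>i. f (C i))"
    unfolding hausdorff_pre_def f_def by (intro INF_lower) auto
  also have "\<dots> = (\<Sum>n. \<Sum>i. f (B n i))"
    unfolding C_def comp_def
    using suminf_ennreal_2dimen[where f="\<lambda>(n,i). f (B n i)" and g="\<lambda>n. \<Sum>i. f (B n i)"]
    by (simp add: split_def)
  also have "\<dots> \<le> (\<Sum>n. hausdorff_pre s \<delta> (A n) + e * (1/2) ^ Suc n)"
    by (intro suminf_le allI Ble) auto
  also have "\<dots> = (\<Sum>n. hausdorff_pre s \<delta> (A n)) + (\<Sum>n. ennreal e * ennreal ((1/2) ^ Suc n))"
    using e by (subst suminf_add[symmetric])
      (auto simp del: ennreal_suminf_cmult simp add: ennreal_mult[symmetric])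
  also have "\<dots> = (\<Sum>n. hausdorff_pre s \<delta> (A n)) + e"
    unfolding ennreal_suminf_cmult
    by (subst suminf_ennreal_eq[OF zero_le_power power_half_series]) auto
  finally show "hausdorff_pre s \<delta> (\<Union>n. A n) \<le> (\<Sum>n. hausdorff_pre s \<delta> (A n)) + e" .
qed

lemma hausdorff_outer_subadditive:
  "hausdorff_outer s (\<Union>n. A n) \<le> (\<Sum>n. hausdorff_outer s (A n))"
  unfolding hausdorff_outer_def[of s "\<Union>n. A n"]
proof (rule SUP_least)
  fix \<delta> :: real assume d: "\<delta> \<in> {0<..}"
  have "hausdorff_pre s \<delta> (\<Union>n. A n) \<le> (\<Sum>n. hausdorff_pre s \<delta> (A n))"
    by (rule hausdorff_pre_subadditive)
  also have "\<dots> \<le> (\<Sum>n. hausdorff_outer s (A n))"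
    unfolding hausdorff_outer_def by (intro suminf_le allI SUP_upper d) auto
  finally show "hausdorff_pre s \<delta> (\<Union>n. A n) \<le> \<dots>" .
qed

lemma hausdorff_pre_empty: "1 \<le> s \<Longrightarrow> 0 < \<delta> \<Longrightarrow> hausdorff_pre s \<delta> ({}::'a::euclidean_space set) = 0"
proof -
  assume s: "1 \<le> s" "0 < \<delta>"
  have "hausdorff_pre s \<delta> ({}::'a set)
      \<le> (\<Sum>i::nat. ennreal (unit_ball_vol (real s) * (diameter ({}::'a set) / 2) ^ s))"
    unfolding hausdorff_pre_def using s by (intro INF_lower2[where i="\<lambda>_. {}"]) auto
  also have "\<dots> = 0" using s by (simp add: zero_power)
  finally show ?thesis by simp
qed

lemma hausdorff_outer_empty: "1 \<le> s \<Longrightarrow> hausdorff_outer s {} = 0"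
proof -
  assume "1 \<le> s"
  then have "hausdorff_outer s ({}::'a set) = (SUP \<delta>\<in>{0::real<..}. 0)"
    unfolding hausdorff_outer_def by (intro SUP_cong) (auto simp: hausdorff_pre_empty)
  then show ?thesis by (simp add: SUP_constant)
qed

lemma hausdorff_outer_subadditive2:
  assumes "1 \<le> s"
  shows "hausdorff_outer s (A \<union> B) \<le> hausdorff_outer s A + hausdorff_outer s B"
proof -
  define D where "D n = (if n = 0 then A else if n = 1 then B else {})" for n :: nat
  have "hausdorff_outer s (A \<union> B) \<le> hausdorff_outer s (\<Union>n. D n)"
    by (rule hausdorff_outer_mono) (force simp: D_def)
  also have "\<dots> \<le> (\<Sum>n. hausdorff_outer s (D n))"
    by (rule hausdorff_outer_subadditive)
  also have "\<dots> = (\<Sum>n\<in>{0,1}. hausdorff_outer s (D n))"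
    using assms by (intro suminf_finite) (auto simp: D_def hausdorff_outer_empty)
  also have "\<dots> = hausdorff_outer s A + hausdorff_outer s B" by (simp add: D_def)
  finally show ?thesis .
qed

lemma hausdorff_pre_separated:
  assumes s: "1 \<le> s" and d: "0 < \<delta>" "\<delta> < r" and sep: "\<And>x y. x \<in> A \<Longrightarrow> y \<in> B \<Longrightarrow> r \<le> dist x y"
  shows "hausdorff_pre s \<delta> A + hausdorff_pre s \<delta> B \<le> hausdorff_pre s \<delta> (A \<union> B)"
  unfolding hausdorff_pre_def[of s \<delta> "A \<union> B"]
proof (rule INF_greatest, clarify)
  fix U :: "nat \<Rightarrow> 'a set"
  assume U: "A \<union> B \<subseteq> (\<Union>i. U i)" "\<forall>i. bounded (U i) \<and> diameter (U i) \<le> \<delta>"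
  define f where "f = (\<lambda>U::'a set. ennreal (unit_ball_vol (real s) * (diameter U / 2) ^ s))"
  define P where "P i = (if U i \<inter> A = {} then {} else U i)" for i
  define Q where "Q i = (if U i \<inter> A = {} then U i else {})" for i
  have "A \<subseteq> (\<Union>i. P i)"
  proof
    fix x assume "x \<in> A"
    then obtain i where "x \<in> U i" using U(1) by blast
    with \<open>x \<in> A\<close> have "x \<in> P i" by (auto simp: P_def)
    then show "x \<in> (\<Union>i. P i)" by blast
  qed
  then have 1: "hausdorff_pre s \<delta> A \<le> (\<Sum>i. f (P i))"
    unfolding hausdorff_pre_def f_def using U(2) d by (intro INF_lower) (auto simp: P_def)
  have "B \<subseteq> (\<Union>i. Q i)"
  proof
    fix y assume "y \<in> B"
    then obtain i where i: "y \<in> U i" using U(1) by blast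
    have "U i \<inter> A = {}"
    proof (rule ccontr)
      assume "U i \<inter> A \<noteq> {}"
      then obtain x where "x \<in> U i" "x \<in> A" by blast
      with i U(2) have "dist x y \<le> \<delta>"
        by (meson diameter_bounded_bound order_trans)
      with sep[OF \<open>x \<in> A\<close> \<open>y \<in> B\<close>] d show False by simp
    qed
    with i have "y \<in> Q i" by (simp add: Q_def)
    then show "y \<in> (\<Union>i. Q i)" by blast
  qed
  then have 2: "hausdorff_pre s \<delta> B \<le> (\<Sum>i. f (Q i))"
    unfolding hausdorff_pre_def f_def using U(2) d by (intro INF_lower) (auto simp: Q_def)
  have "f (P i) + f (Q i) = f (U i)" for i
    using s by (auto simp: P_def Q_def f_def zero_power)
  then have "(\<Sum>i. f (P i)) + (\<Sum>i. f (Q i)) = (\<Sum>i. f (U i))"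
    by (subst suminf_add) auto
  then show "hausdorff_pre s \<delta> A + hausdorff_pre s \<delta> B
      \<le> (\<Sum>i. ennreal (unit_ball_vol (real s) * (diameter (U i) / 2) ^ s))"
    using add_mono[OF 1 2] by (simp add: f_def)
qed

lemma hausdorff_outer_separated:
  assumes s: "1 \<le> s" and r: "0 < r" and sep: "\<And>x y. x \<in> A \<Longrightarrow> y \<in> B \<Longrightarrow> r \<le> dist x y"
  shows "hausdorff_outer s (A \<union> B) = hausdorff_outer s A + hausdorff_outer s B"
proof (rule antisym[OF hausdorff_outer_subadditive2[OF s]])
  have 1: "hausdorff_pre s \<alpha> A + hausdorff_pre s \<beta> B \<le> hausdorff_outer s (A \<union> B)"
    if "0 < \<alpha>" "0 < \<beta>" for \<alpha> \<beta>
  proof -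
    define \<delta> where "\<delta> = min (min \<alpha> \<beta>) (r/2)"
    have \<delta>: "0 < \<delta>" "\<delta> < r" "\<delta> \<le> \<alpha>" "\<delta> \<le> \<beta>" using that r by (auto simp: \<delta>_def)
    have "hausdorff_pre s \<alpha> A + hausdorff_pre s \<beta> B \<le> hausdorff_pre s \<delta> A + hausdorff_pre s \<delta> B"
      by (intro add_mono hausdorff_pre_antimono \<delta>)
    also have "\<dots> \<le> hausdorff_pre s \<delta> (A \<union> B)"
      by (rule hausdorff_pre_separated[OF s \<delta>(1,2) sep])
    also have "\<dots> \<le> hausdorff_outer s (A \<union> B)"
      unfolding hausdorff_outer_def using \<delta> by (intro SUP_upper) auto
    finally show ?thesis .
  qed
  have ne: "{0::real<..} \<noteq> {}" by (auto intro: exI[of _ 1])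
  have "hausdorff_pre s \<alpha> A + hausdorff_outer s B \<le> hausdorff_outer s (A \<union> B)" if "0 < \<alpha>" for \<alpha>
    unfolding hausdorff_outer_def[of s B] using 1[OF that] ne
    by (simp add: ennreal_SUP_add_right SUP_le_iff)
  then show "hausdorff_outer s A + hausdorff_outer s B \<le> hausdorff_outer s (A \<union> B)"
    unfolding hausdorff_outer_def[of s A] using ne
    by (simp add: ennreal_SUP_add_left[symmetric] SUP_le_iff)
qed

text \<open>Caratheodory's criterion: a metric outer measure is additive on Borel sets.\<close>

lemma hausdorff_closed_split:
  fixes E A :: "'a::euclidean_space set"
  assumes s: "1 \<le> s" and E: "closed E"
  shows "hausdorff_outer s (A \<inter> E) + hausdorff_outer s (A - E) \<le> hausdorff_outer s A"
proof (cases "E = {} \<or> hausdorff_outer s A = top")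
  case True
  then show ?thesis using s by (auto simp: hausdorff_outer_empty)
next
  case False
  let ?\<mu> = "hausdorff_outer s :: 'a set \<Rightarrow> ennreal"
  define d where "d x = infdist x E" for x
  define G where "G n = {x \<in> A. 1 / real (n + 1) < d x}" for n
  define D where "D j = {x \<in> A. 1 / real (j + 2) < d x \<and> d x \<le> 1 / real (j + 1)}" for j
  have lip: "d x - d y \<le> dist x y" for x y
    using infdist_triangle[of x E y] by (simp add: d_def)
  have E0: "d x = 0 \<longleftrightarrow> x \<in> E" for x
    using E False by (simp add: d_def in_closed_iff_infdist_zero)
  have dnn: "0 \<le> d x" for x by (simp add: d_def infdist_nonneg)
  have G: "?\<mu> (A \<inter> E) + ?\<mu> (G n) \<le> ?\<mu> A" for n
  proof -
    have "?\<mu> ((A \<inter> E) \<union> G n) = ?\<mu> (A \<inter> E) + ?\<mu> (G n)"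
    proof (rule hausdorff_outer_separated[OF s])
      show "0 < 1 / real (n + 1)" by simp
      fix x y assume "x \<in> A \<inter> E" "y \<in> G n"
      then show "1 / real (n + 1) \<le> dist x y"
        using lip[of y x] E0[of x] by (simp add: G_def dist_commute)
    qed
    moreover have "?\<mu> ((A \<inter> E) \<union> G n) \<le> ?\<mu> A"
      by (rule hausdorff_outer_mono) (auto simp: G_def)
    ultimately show ?thesis by simp
  qed
  have par: "(\<Sum>j<m. ?\<mu> (D (2*j + p))) = ?\<mu> (\<Union>j<m. D (2*j + p))" for m p
  proof (induction m)
    case 0
    then show ?case using s by (simp add: hausdorff_outer_empty)
  next
    case (Suc m)
    let ?N = "2*m + p"
    show ?case
    proof (cases "m = 0")
      case True
      then show ?thesis by (simp add: lessThan_Suc)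
    next
      case m: False
      have "?\<mu> ((\<Union>j<m. D (2*j + p)) \<union> D ?N) = ?\<mu> (\<Union>j<m. D (2*j + p)) + ?\<mu> (D ?N)"
      proof (rule hausdorff_outer_separated[OF s])
        show "0 < 1 / real ?N - 1 / real (?N + 1)"
          using m by (simp add: frac_less2)
        fix x y assume "x \<in> (\<Union>j<m. D (2*j + p))" "y \<in> D ?N"
        then obtain j where j: "j < m" "x \<in> D (2*j + p)" by blast
        have "1 / real ?N \<le> 1 / real (2*j + p + 2)"
          using j m by (intro divide_left_mono) auto
        also have "\<dots> < d x" using j by (simp add: D_def)
        finally show "1 / real ?N - 1 / real (?N + 1) \<le> dist x y"
          using lip[of x y] \<open>y \<in> D ?N\<close> by (simp add: D_def)
      qed
      then show ?thesis using Suc.IH by (simp add: lessThan_Suc Un_commute add.commute)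
    qed
  qed
  have par_le: "(\<Sum>j<m. ?\<mu> (D (2*j + p))) \<le> ?\<mu> A" for m p
    unfolding par by (rule hausdorff_outer_mono) (auto simp: D_def)
  have split: "(\<Sum>j<2*m. g j) = (\<Sum>j<m. g (2*j + 0)) + (\<Sum>j<m. g (2*j + 1))"
    for m and g :: "nat \<Rightarrow> ennreal"
    by (induction m) (auto simp: algebra_simps)
  define c where "c = (\<Sum>j. ?\<mu> (D j))"
  have c: "c \<le> ?\<mu> A + ?\<mu> A"
    unfolding c_def
  proof (rule suminf_le_const[OF summableI])
    fix n
    have "(\<Sum>j<n. ?\<mu> (D j)) \<le> (\<Sum>j<2*n. ?\<mu> (D j))" by (intro sum_mono2) auto
    also have "\<dots> \<le> ?\<mu> A + ?\<mu> A" unfolding split by (intro add_mono par_le)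
    finally show "(\<Sum>j<n. ?\<mu> (D j)) \<le> ?\<mu> A + ?\<mu> A" .
  qed
  have "?\<mu> A + ?\<mu> A < top" using False by (simp add: less_top)
  with c have cfin: "c < top" by (rule le_less_trans)
  have cover: "A - E \<subseteq> G n \<union> (\<Union>j. D (j + n))" for n
  proof
    fix x assume x: "x \<in> A - E"
    then have dx: "0 < d x" using E0[of x] dnn[of x] by force
    show "x \<in> G n \<union> (\<Union>j. D (j + n))"
    proof (cases "1 / real (n + 1) < d x")
      case True
      then show ?thesis using x by (simp add: G_def)
    next
      case nG: False
      define k where "k = (LEAST k. 1 / real (k + 1) < d x)"
      obtain k0 where "1 / real (Suc k0) < d x"
        by (rule nat_approx_posE[OF dx])
      then have k: "1 / real (k + 1) < d x"
        using LeastI[of "\<lambda>k. 1 / real (k + 1) < d x" k0] unfolding k_def by simp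
      have least: "\<not> 1 / real (i + 1) < d x" if "i < k" for i
        using not_less_Least[of i "\<lambda>k. 1 / real (k + 1) < d x"] that unfolding k_def by simp
      have "n < k"
      proof (rule ccontr)
        assume "\<not> n < k"
        then have "1 / real (n + 1) \<le> 1 / real (k + 1)" by (intro divide_left_mono) auto
        with k nG show False by linarith
      qed
      then obtain j where j: "k = j + n + 1" 
        by (metis less_imp_Suc_add add.commute Suc_eq_plus1)
      have "x \<in> D (j + n)"
        using k least[of "j + n"] x by (simp add: D_def j algebra_simps)
      then show ?thesis by blast
    qed
  qed
  have main: "?\<mu> (A \<inter> E) + ?\<mu> (A - E) + (\<Sum>j<n. ?\<mu> (D j)) \<le> ?\<mu> A + c" for n
  proof -
    have "?\<mu> (A - E) \<le> ?\<mu> (G n) + ?\<mu> (\<Union>j. D (j + n))"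
      by (rule order_trans[OF hausdorff_outer_mono[OF cover] hausdorff_outer_subadditive2[OF s]])
    also have "\<dots> \<le> ?\<mu> (G n) + (\<Sum>j. ?\<mu> (D (j + n)))"
      by (intro add_left_mono hausdorff_outer_subadditive)
    finally have "?\<mu> (A \<inter> E) + ?\<mu> (A - E) + (\<Sum>j<n. ?\<mu> (D j))
        \<le> ?\<mu> (A \<inter> E) + (?\<mu> (G n) + (\<Sum>j. ?\<mu> (D (j + n)))) + (\<Sum>j<n. ?\<mu> (D j))"
      by (intro add_mono order_refl)
    also have "\<dots> = (?\<mu> (A \<inter> E) + ?\<mu> (G n)) + c"
      unfolding c_def suminf_offset[OF summableI, of "\<lambda>j. ?\<mu> (D j)" n]
      by (simp add: add.commute add.left_commute add.assoc)
    also have "\<dots> \<le> ?\<mu> A + c" by (intro add_right_mono G)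
    finally show ?thesis .
  qed
  have "?\<mu> (A \<inter> E) + ?\<mu> (A - E) + c
      = (SUP n. ?\<mu> (A \<inter> E) + ?\<mu> (A - E) + (\<Sum>j<n. ?\<mu> (D j)))"
    unfolding c_def suminf_eq_SUP by (subst ennreal_SUP_add_right) auto
  also have "\<dots> \<le> ?\<mu> A + c" by (intro SUP_least main)
  finally show ?thesis using cfin by (auto simp: add.commute[of _ c] ennreal_add_left_cancel_le)
qed

lemma measure_space_hausdorff_outer:
  assumes s: "1 \<le> s"
  shows "measure_space UNIV (sets borel) (hausdorff_outer s :: 'a::euclidean_space set \<Rightarrow> ennreal)"
proof (rule measure_down)
  let ?L = "lambda_system UNIV (Pow UNIV) (hausdorff_outer s :: 'a set \<Rightarrow> ennreal)"
  have "outer_measure_space (Pow UNIV) (hausdorff_outer s :: 'a set \<Rightarrow> ennreal)"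
    using s by (auto simp: outer_measure_space_def positive_def increasing_def
        countably_subadditive_def hausdorff_outer_empty hausdorff_outer_mono
        hausdorff_outer_subadditive)
  then show L: "measure_space UNIV ?L (hausdorff_outer s)"
    by (intro sigma_algebra.caratheodory_lemma sigma_algebra_Pow)
  show "sigma_algebra UNIV (sets (borel :: 'a measure))"
    by (metis sets.sigma_algebra_axioms space_borel)
  have cl: "E \<in> ?L" if "closed E" for E :: "'a set"
    unfolding lambda_system_def
  proof (clarsimp)
    fix A :: "'a set"
    have "hausdorff_outer s A \<le> hausdorff_outer s (A \<inter> E) + hausdorff_outer s (A - E)"
      using hausdorff_outer_subadditive2[OF s, of "A \<inter> E" "A - E"] by (simp add: Int_Diff_Un)
    then have "hausdorff_outer s (A \<inter> E) + hausdorff_outer s (A - E) = hausdorff_outer s A"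
      using hausdorff_closed_split[OF s that, of A] by (rule antisym[rotated])
    then show "hausdorff_outer s (E \<inter> A) + hausdorff_outer s ((UNIV - E) \<inter> A) = hausdorff_outer s A"
      by (simp add: Int_commute Diff_eq)
  qed
  have "sets (borel::'a measure) = sigma_sets UNIV (Collect closed)"
    by (simp add: borel_eq_closed)
  also have "\<dots> \<subseteq> ?L"
    using L cl by (intro sigma_algebra.sigma_sets_subset) (auto simp: measure_space_def)
  finally show "sets (borel::'a measure) \<subseteq> ?L" .
qed

lemma sets_hausdorff [simp]: "sets (hausdorff s) = sets borel"
  and space_hausdorff [simp]: "space (hausdorff s) = UNIV"
  unfolding hausdorff_def by (simp_all add: sets_measure_of_conv space_measure_of_conv
      sigma_algebra.sigma_sets_eq[OF sets.sigma_algebra_axioms[of borel, simplified]])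

lemma emeasure_hausdorff:
  assumes "1 \<le> s" "A \<in> sets borel"
  shows "emeasure (hausdorff s) A = hausdorff_outer s A"
  unfolding hausdorff_def using measure_space_hausdorff_outer[OF assms(1)] assms(2)
  by (intro emeasure_measure_of_sigma) (auto simp: measure_space_def)


section \<open>Domain and mesh\<close>

text \<open>In a ball around each boundary point, \<open>\<Omega>\<close> is the strict subgraph of a Lipschitz function
  \<open>g\<close> over the hyperplane orthogonal to \<open>e\<close>.\<close>

definition lipschitz_domain :: "'a::euclidean_space set \<Rightarrow> bool" where
  "lipschitz_domain \<Omega> \<longleftrightarrow> open \<Omega> \<and> connected \<Omega> \<and> \<Omega> \<noteq> {} \<and>
     (\<forall>x\<in>frontier \<Omega>. \<exists>e r L g. norm e = 1 \<and> r > 0 \<and> L-lipschitz_on {z. z \<bullet> e = 0} g \<and>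
        \<Omega> \<inter> ball x r = {y \<in> ball x r. y \<bullet> e < g (y - (y \<bullet> e) *\<^sub>R e)})"

definition polyhedral_domain :: "'a::euclidean_space set \<Rightarrow> bool" where
  "polyhedral_domain D \<longleftrightarrow> open D \<and> connected D \<and> D \<noteq> {} \<and> bounded D \<and>
     (\<exists>\<P>. finite \<P> \<and> (\<forall>P\<in>\<P>. polytope P) \<and> frontier D = \<Union>\<P>)"

text \<open>The tangent hyperplane to the boundary at \<open>x\<close> is orthogonal to \<open>\<nu>\<close>, and \<open>\<Omega>\<close> lies on the
  \<open>-\<nu>\<close> side. On a Lipschitz boundary such a \<open>\<nu>\<close> exists (and is unique) only almost everywhere.\<close>

definition outward_unit_normal :: "'a::euclidean_space set \<Rightarrow> 'a \<Rightarrow> 'a \<Rightarrow> bool" where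
  "outward_unit_normal \<Omega> x \<nu> \<longleftrightarrow> norm \<nu> = 1 \<and>
     (\<forall>\<epsilon>>0. \<exists>r>0. \<forall>y\<in>ball x r.
        ((y - x) \<bullet> \<nu> < - \<epsilon> * norm (y - x) \<longrightarrow> y \<in> \<Omega>) \<and>
        ((y - x) \<bullet> \<nu> > \<epsilon> * norm (y - x) \<longrightarrow> y \<notin> \<Omega>))"

definition outward_normal_field :: "(real^'d) set \<Rightarrow> (real^'d \<Rightarrow> real^'d) \<Rightarrow> bool" where
  "outward_normal_field \<Omega> n \<longleftrightarrow>
     n \<in> borel_measurable (restrict_space borel (frontier \<Omega>)) \<and>
     (AE x in hausdorff (CARD('d) - 1). x \<in> frontier \<Omega> \<longrightarrow> outward_unit_normal \<Omega> x (n x))"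

definition simplicial_triangulation_of :: "(real^'d) set \<Rightarrow> (real^'d) set set \<Rightarrow> bool" where
  "simplicial_triangulation_of D \<T> \<longleftrightarrow>
     triangulation \<T> \<and> (\<forall>T\<in>\<T>. int CARD('d) simplex T) \<and> \<Union>\<T> = closure D"

text \<open>The inradius of a simplex is bounded below by a fixed multiple of its diameter, uniformly
  over the family.\<close>

definition shape_regular :: "(real \<Rightarrow> 'a::euclidean_space set set) \<Rightarrow> bool" where
  "shape_regular \<T> \<longleftrightarrow>
     (\<exists>\<sigma>>0. \<forall>h>0. \<forall>T\<in>\<T> h. \<exists>x. ball x (\<sigma> * diameter T) \<subseteq> T)"

definition active_mesh :: "(real^'d) set \<Rightarrow> (real^'d) set set \<Rightarrow> (real^'d) set set" where
  "active_mesh \<Omega> \<T> = {T \<in> \<T>. emeasure (hausdorff (CARD('d) - 1)) (T \<inter> \<Omega>) > 0}"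

definition cut_elements :: "'a::euclidean_space set \<Rightarrow> 'a set set \<Rightarrow> 'a set set" where
  "cut_elements \<Omega> \<T> = {T \<in> \<T>. T \<inter> frontier \<Omega> \<noteq> {}}"

definition ghost_faces :: "'a::euclidean_space set \<Rightarrow> 'a set set \<Rightarrow> 'a set set" where
  "ghost_faces \<Omega> \<T> =
     {F. (\<exists>T\<in>cut_elements \<Omega> \<T>. F facet_of T) \<and> \<not> F \<subseteq> frontier (\<Union>\<T>)}"

section \<open>Finite element spaces\<close>

definition poly_space :: "nat \<Rightarrow> (real^'d \<Rightarrow> real) set" where
  "poly_space k = {p. \<exists>c. p = (\<lambda>x. \<Sum>\<alpha>\<in>{\<alpha>::'d \<Rightarrow> nat. (\<Sum>i\<in>UNIV. \<alpha> i) \<le> k}.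
     c \<alpha> * (\<Prod>i\<in>UNIV. (x $ i) ^ \<alpha> i))}"

text \<open>Functions on \<open>\<Union>\<T>\<close> are represented by total functions that vanish elsewhere, so that
  equality in the space is equality of HOL functions.\<close>

definition fe_space :: "nat \<Rightarrow> (real^'d) set set \<Rightarrow> (real^'d \<Rightarrow> real) set" where
  "fe_space k \<T> = {v. continuous_on (\<Union>\<T>) v \<and>
     (\<forall>T\<in>\<T>. \<exists>p\<in>poly_space k. \<forall>x\<in>T. v x = p x) \<and> (\<forall>x. x \<notin> \<Union>\<T> \<longrightarrow> v x = 0)}"

text \<open>Lagrange nodes: the points of a simplex whose barycentric coordinates are multiples of
  \<open>1/k\<close>.\<close>

definition lagrange_nodes :: "nat \<Rightarrow> 'a::euclidean_space set \<Rightarrow> 'a set" where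
  "lagrange_nodes k T = {x. \<exists>m :: 'a \<Rightarrow> nat. (\<Sum>a | a extreme_point_of T. m a) = k \<and>
     x = (\<Sum>a | a extreme_point_of T. (real (m a) / real k) *\<^sub>R a)}"

definition fe_span :: "(nat \<Rightarrow> 'a \<Rightarrow> real) \<Rightarrow> nat set \<Rightarrow> ('a \<Rightarrow> real) set" where
  "fe_span \<phi> I = {v. \<exists>c. v = (\<lambda>x. \<Sum>i\<in>I. c i * \<phi> i x)}"

text \<open>Linear independence of \<open>\<phi> 1, \<dots>, \<phi> N\<close> follows from the Kronecker property.\<close>

definition nodal_basis ::
    "nat \<Rightarrow> (real^'d) set set \<Rightarrow> nat \<Rightarrow> (nat \<Rightarrow> real^'d) \<Rightarrow> (nat \<Rightarrow> real^'d \<Rightarrow> real) \<Rightarrow> bool" where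
  "nodal_basis k \<T> N \<xi> \<phi> \<longleftrightarrow>
     bij_betw \<xi> {1..N} (\<Union>T\<in>\<T>. lagrange_nodes k T) \<and>
     (\<forall>i\<in>{1..N}. \<forall>j\<in>{1..N}. \<phi> i (\<xi> j) = (if i = j then 1 else 0)) \<and>
     fe_space k \<T> = fe_span \<phi> {1..N}"

section \<open>The bilinear form\<close>

definition grad :: "('a::euclidean_space \<Rightarrow> real) \<Rightarrow> 'a \<Rightarrow> 'a" where
  "grad f x = (THE D. GDERIV f x :> D)"

definition l2_inner :: "'a::euclidean_space set \<Rightarrow> ('a \<Rightarrow> real) \<Rightarrow> ('a \<Rightarrow> real) \<Rightarrow> real" where
  "l2_inner D u v = (LINT x:D|lebesgue. u x * v x)"

definition surface_inner :: "(real^'d) set \<Rightarrow> (real^'d \<Rightarrow> real) \<Rightarrow> (real^'d \<Rightarrow> real) \<Rightarrow> real" where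
  "surface_inner S u v = (LINT x:S|hausdorff (CARD('d) - 1). u x * v x)"

text \<open>The polynomial that agrees with \<open>u\<close> on the element \<open>T\<close>; traces of derivatives of \<open>u\<close> on the
  boundary of \<open>T\<close>, taken from inside \<open>T\<close>, are values of derivatives of this polynomial.\<close>

definition local_poly :: "nat \<Rightarrow> (real^'d) set \<Rightarrow> (real^'d \<Rightarrow> real) \<Rightarrow> real^'d \<Rightarrow> real" where
  "local_poly k T u = (THE p. p \<in> poly_space k \<and> (\<forall>x\<in>T. p x = u x))"

text \<open>The normal derivative \<open>n \<bullet> \<nabla>u\<close> on \<open>\<Gamma>\<close> is the trace from inside \<open>\<Omega>\<close>. This matters only where
  \<open>\<Gamma>\<close> runs along an element face: there the gradient is taken in the element that is entered
  when moving from \<open>x\<close> in direction \<open>-n x\<close>. If that segment runs inside a common face of several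
  elements, the choice among them does not affect \<open>n \<bullet> \<nabla>u\<close>.\<close>

definition inner_element :: "'a::euclidean_space set set \<Rightarrow> 'a \<Rightarrow> 'a \<Rightarrow> 'a set" where
  "inner_element \<T> x \<nu> =
     (SOME T. T \<in> \<T> \<and> (\<forall>\<^sub>F t in at_right 0. x - t *\<^sub>R \<nu> \<in> T))"

definition boundary_normal_deriv ::
    "nat \<Rightarrow> (real^'d) set set \<Rightarrow> (real^'d \<Rightarrow> real^'d) \<Rightarrow> (real^'d \<Rightarrow> real) \<Rightarrow> real^'d \<Rightarrow> real" where
  "boundary_normal_deriv k \<T> n u x =
     n x \<bullet> grad (local_poly k (inner_element \<T> x (n x)) u) x"

text \<open>Jumps across a face depend on the order of the two adjacent elements and on the orientation
  of the normal only through a sign, which cancels in products of two jumps of the same order.\<close>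

definition face_elements :: "'a::euclidean_space set set \<Rightarrow> 'a set \<Rightarrow> 'a set \<times> 'a set" where
  "face_elements \<T> F = (SOME (T1, T2). T1 \<in> \<T> \<and> T2 \<in> \<T> \<and> T1 \<noteq> T2 \<and> F facet_of T1 \<and> F facet_of T2)"

definition face_normal :: "'a::euclidean_space set \<Rightarrow> 'a" where
  "face_normal F = (SOME \<nu>. norm \<nu> = 1 \<and> (\<forall>x\<in>F. \<forall>y\<in>F. (x - y) \<bullet> \<nu> = 0))"

definition dir_deriv :: "nat \<Rightarrow> 'a::euclidean_space \<Rightarrow> ('a \<Rightarrow> real) \<Rightarrow> 'a \<Rightarrow> real" where
  "dir_deriv l \<nu> p x = (deriv ^^ l) (\<lambda>t::real. p (x + t *\<^sub>R \<nu>)) 0"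

definition normal_jump ::
    "nat \<Rightarrow> (real^'d) set set \<Rightarrow> (real^'d) set \<Rightarrow> nat \<Rightarrow> (real^'d \<Rightarrow> real) \<Rightarrow> real^'d \<Rightarrow> real" where
  "normal_jump k \<T> F l u x = (case face_elements \<T> F of (T1, T2) \<Rightarrow>
     dir_deriv l (face_normal F) (local_poly k T1 u) x
     - dir_deriv l (face_normal F) (local_poly k T2 u) x)"

definition cut_form ::
    "nat \<Rightarrow> real \<Rightarrow> real \<Rightarrow> (real^'d) set \<Rightarrow> (real^'d \<Rightarrow> real^'d) \<Rightarrow> (real^'d) set set
      \<Rightarrow> (real^'d \<Rightarrow> real) \<Rightarrow> (real^'d \<Rightarrow> real) \<Rightarrow> real" where
  "cut_form k \<gamma> \<beta> \<Omega> n \<T> u v =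
     (LINT x:\<Omega>|lebesgue. grad u x \<bullet> grad v x)
     - surface_inner (frontier \<Omega>) (boundary_normal_deriv k \<T> n u) v
     - surface_inner (frontier \<Omega>) u (boundary_normal_deriv k \<T> n v)
     + \<gamma> * (\<Sum>T\<in>cut_elements \<Omega> \<T>. inverse (diameter T) * surface_inner (T \<inter> frontier \<Omega>) u v)
     + \<beta> * (\<Sum>l=1..k. \<Sum>F\<in>ghost_faces \<Omega> \<T>. diameter F ^ (2 * l - 1) *
           surface_inner F (normal_jump k \<T> F l u) (normal_jump k \<T> F l v))"

definition spd_form :: "('a \<Rightarrow> real) set \<Rightarrow> (('a \<Rightarrow> real) \<Rightarrow> ('a \<Rightarrow> real) \<Rightarrow> real) \<Rightarrow> bool" where
  "spd_form V a \<longleftrightarrow> (\<forall>u\<in>V. \<forall>v\<in>V. a u v = a v u) \<and> (\<forall>u\<in>V. u \<noteq> (\<lambda>_. 0) \<longrightarrow> a u u > 0)"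

definition form_norm :: "(('a \<Rightarrow> real) \<Rightarrow> ('a \<Rightarrow> real) \<Rightarrow> real) \<Rightarrow> ('a \<Rightarrow> real) \<Rightarrow> real" where
  "form_norm a v = sqrt (a v v)"

section \<open>Operators and spectrum\<close>

definition l2_projection ::
    "'a::euclidean_space set \<Rightarrow> ('a \<Rightarrow> real) set \<Rightarrow> ('a \<Rightarrow> real) set \<Rightarrow> (('a \<Rightarrow> real) \<Rightarrow> 'a \<Rightarrow> real) \<Rightarrow> bool" where
  "l2_projection D V W Q \<longleftrightarrow>
     (\<forall>u\<in>V. Q u \<in> W \<and> (\<forall>w\<in>W. l2_inner D (\<lambda>x. u x - Q u x) w = 0))"

definition represents_form ::
    "'a::euclidean_space set \<Rightarrow> ('a \<Rightarrow> real) set \<Rightarrow> (('a \<Rightarrow> real) \<Rightarrow> ('a \<Rightarrow> real) \<Rightarrow> real)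
      \<Rightarrow> (('a \<Rightarrow> real) \<Rightarrow> 'a \<Rightarrow> real) \<Rightarrow> bool" where
  "represents_form D V a A \<longleftrightarrow> (\<forall>u\<in>V. A u \<in> V \<and> (\<forall>v\<in>V. l2_inner D (A u) v = a u v))"

definition spd_operator ::
    "'a::euclidean_space set \<Rightarrow> ('a \<Rightarrow> real) set \<Rightarrow> (('a \<Rightarrow> real) \<Rightarrow> 'a \<Rightarrow> real) \<Rightarrow> bool" where
  "spd_operator D V B \<longleftrightarrow> (\<forall>u\<in>V. B u \<in> V) \<and>
     (\<forall>u\<in>V. \<forall>v\<in>V. \<forall>c d. B (\<lambda>x. c * u x + d * v x) = (\<lambda>x. c * B u x + d * B v x)) \<and>
     (\<forall>u\<in>V. \<forall>v\<in>V. l2_inner D (B u) v = l2_inner D u (B v)) \<and>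
     (\<forall>u\<in>V. u \<noteq> (\<lambda>_. 0) \<longrightarrow> l2_inner D (B u) u > 0)"

text \<open>The spectrum of a linear operator \<open>L\<close> on a real (here always finite-dimensional) function
  space \<open>V\<close> is that of its complexification, acting on the complex-valued functions whose real and
  imaginary parts lie in \<open>V\<close>.\<close>

definition complexification :: "('a \<Rightarrow> real) set \<Rightarrow> ('a \<Rightarrow> complex) set" where
  "complexification V = {f. (\<lambda>x. Re (f x)) \<in> V \<and> (\<lambda>x. Im (f x)) \<in> V}"

definition complexify_op ::
    "(('a \<Rightarrow> real) \<Rightarrow> 'a \<Rightarrow> real) \<Rightarrow> ('a \<Rightarrow> complex) \<Rightarrow> 'a \<Rightarrow> complex" where
  "complexify_op L f = (\<lambda>x. Complex (L (\<lambda>y. Re (f y)) x) (L (\<lambda>y. Im (f y)) x))"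

definition op_spectrum :: "('a \<Rightarrow> real) set \<Rightarrow> (('a \<Rightarrow> real) \<Rightarrow> 'a \<Rightarrow> real) \<Rightarrow> complex set" where
  "op_spectrum V L = {z. \<not> bij_betw (\<lambda>f x. z * f x - complexify_op L f x)
     (complexification V) (complexification V)}"

end

theory Submission
  imports Defs "HOL-Library.Function_Algebras"
begin

text \<open>Writing \<open>T\<^sub>l u\<close> for the element of \<open>V\<^sub>l\<close> with \<open>(B\<^sub>l T\<^sub>l u, v) = a(u, v)\<close> for all \<open>v \<in> V\<^sub>l\<close>, one has
  \<open>CA = T\<^sub>0 + T\<^sub>1\<close>. Each \<open>T\<^sub>l\<close> is symmetric with respect to \<open>a\<close>, so the spectrum is real. For an
  eigenvector \<open>u\<close> the upper bound follows from
  \<open>a(CAu, CAu) \<le> 2 \<Sum>\<^sub>l a(T\<^sub>l u, T\<^sub>l u) \<le> 2 \<rho> \<Sum>\<^sub>l (B\<^sub>l T\<^sub>l u, T\<^sub>l u) = 2 \<rho> a(CAu, u)\<close>. The lower bound follows by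
  splitting \<open>u = u\<^sub>0 + u\<^sub>1\<close> and applying Young's inequality to \<open>a(u, u) = \<Sum>\<^sub>l (B\<^sub>l T\<^sub>l u, u\<^sub>l)\<close>. The spectrum
  consists of eigenvalues because all spaces have finite dimension.\<close>

section \<open>Finite-dimensional spaces of functions\<close>

text \<open>Rank-nullity for an endomorphism of a finite-dimensional \<open>W\<close>: trivial
  kernel sends a basis to an independent set of the same size, which must again span
  \<open>W\<close>. Linearity is asked for on \<open>W\<close> only, since the operators of the
  finite element spaces are specified only there.\<close>

lemma (in vector_space) linear_inj_on_imp_surj:
  assumes W: "subspace W" "W \<subseteq> span S" "finite S"
    and maps: "\<And>x. x \<in> W \<Longrightarrow> L x \<in> W"
    and add: "\<And>x y. x \<in> W \<Longrightarrow> y \<in> W \<Longrightarrow> L (x + y) = L x + L y"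
    and scale: "\<And>c x. x \<in> W \<Longrightarrow> L (scale c x) = scale c (L x)"
    and ker: "\<And>x. x \<in> W \<Longrightarrow> L x = 0 \<Longrightarrow> x = 0"
  shows "bij_betw L W W"
proof -
  have diff: "L (x - y) = L x - L y" if "x \<in> W" "y \<in> W" for x y
    using add[of "x - y" y] that subspace_diff[OF W(1)] by (simp add: algebra_simps)
  have inj: "inj_on L W"
  proof (rule inj_onI)
    fix x y assume "x \<in> W" "y \<in> W" "L x = L y"
    then show "x = y"
      using ker[of "x - y"] diff subspace_diff[OF W(1)] by simp
  qed
  obtain T where T: "T \<subseteq> W" "independent T" "W \<subseteq> span T"
    using maximal_independent_subset by blast
  have finT: "finite T"
    using independent_span_bound[OF W(3) T(2)] T(1) W(2) by blast
  have lincomb: "L (\<Sum>t\<in>U. scale (c t) t) = (\<Sum>t\<in>U. scale (c t) (L t))" if "finite U" "U \<subseteq> W" for U c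
    using that
  proof (induction U rule: finite_induct)
    case empty
    then show ?case using diff[of 0 0] subspace_0[OF W(1)] by simp
  next
    case (insert t U)
    then have "(\<Sum>t\<in>U. scale (c t) t) \<in> W" "scale (c t) t \<in> W"
      using W(1) by (auto intro: subspace_sum subspace_scale)
    then show ?case using insert by (simp add: add scale)
  qed
  have injT: "inj_on L T" using inj T(1) by (rule inj_on_subset)
  have indep: "independent (L ` T)"
  proof (rule independent_if_scalars_zero)
    fix f y assume 0: "(\<Sum>y\<in>L ` T. scale (f y) y) = 0" and y: "y \<in> L ` T"
    then obtain t where t: "t \<in> T" "y = L t" by blast
    have "L (\<Sum>t\<in>T. scale (f (L t)) t) = 0"
      using 0 lincomb[OF finT T(1)] by (simp add: sum.reindex[OF injT])
    moreover have "(\<Sum>t\<in>T. scale (f (L t)) t) \<in> W"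
      using T(1) W(1) by (intro subspace_sum subspace_scale) auto
    ultimately have "(\<Sum>t\<in>T. scale (f (L t)) t) = 0" using ker by blast
    then show "f y = 0" using independentD[OF T(2) finT] t by fastforce
  qed (use finT in simp)
  \<comment> \<open>A vector of \<open>W\<close> outside this span would give
    \<open>card T + 1\<close> independent vectors inside \<open>span T\<close>, against the exchange
    bound.\<close>
  have span: "W \<subseteq> span (L ` T)"
  proof (rule ccontr)
    assume "\<not> ?thesis"
    then obtain x where x: "x \<in> W" "x \<notin> span (L ` T)" by blast
    have "independent (insert x (L ` T))" using x indep by (simp add: independent_insertI)
    moreover have "insert x (L ` T) \<subseteq> span T" using x maps T by blast
    ultimately have "card (insert x (L ` T)) \<le> card T"
      using independent_span_bound[OF finT] by blast
    moreover have "x \<notin> L ` T" using x(2) span_superset by blast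
    ultimately show False using finT by (simp add: card_image[OF injT])
  qed
  have "W \<subseteq> L ` W"
  proof
    fix x assume "x \<in> W"
    then have "x \<in> span (L ` T)" using span by blast
    then obtain c where "x = (\<Sum>t\<in>T. scale (c (L t)) (L t))"
      using finT by (auto simp: span_finite sum.reindex[OF injT])
    then have "x = L (\<Sum>t\<in>T. scale (c (L t)) t)" using lincomb[OF finT T(1)] by simp
    moreover have "(\<Sum>t\<in>T. scale (c (L t)) t) \<in> W"
      using T(1) W(1) by (intro subspace_sum subspace_scale) auto
    ultimately show "x \<in> L ` W" by blast
  qed
  then show ?thesis using inj maps by (auto simp: bij_betw_def)
qed

text \<open>Generic in the scalars, so that one interpretation of \<open>vector_space\<close> serves
  both the real function spaces and their complexifications.\<close>

definition fscale :: "'b::times \<Rightarrow> ('a \<Rightarrow> 'b) \<Rightarrow> 'a \<Rightarrow> 'b" where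
  "fscale c f = (\<lambda>x. c * f x)"

lemma fscale_apply [simp]: "fscale c f x = c * f x"
  by (simp add: fscale_def)

interpretation fun_space: vector_space "fscale :: 'b::field \<Rightarrow> ('a \<Rightarrow> 'b) \<Rightarrow> 'a \<Rightarrow> 'b"
  by standard (auto simp: fun_eq_iff algebra_simps)

lemma sum_fun_apply: "(\<Sum>i\<in>I. f i) x = (\<Sum>i\<in>I. f i x :: 'b::comm_monoid_add)"
  by (induction I rule: infinite_finite_induct) auto

lemma subspace_fe_span: "fun_space.subspace (fe_span \<phi> I)"
proof (rule fun_space.subspaceI)
  show "0 \<in> fe_span \<phi> I"
    by (auto simp: fe_span_def fun_eq_iff intro!: exI[of _ "\<lambda>_. 0"])
next
  fix u v assume "u \<in> fe_span \<phi> I" "v \<in> fe_span \<phi> I"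
  then obtain c d where "u = (\<lambda>x. \<Sum>i\<in>I. c i * \<phi> i x)" "v = (\<lambda>x. \<Sum>i\<in>I. d i * \<phi> i x)"
    by (auto simp: fe_span_def)
  then show "u + v \<in> fe_span \<phi> I"
    by (auto simp: fe_span_def fun_eq_iff sum.distrib algebra_simps intro!: exI[of _ "\<lambda>i. c i + d i"])
next
  fix r u assume "u \<in> fe_span \<phi> I"
  then obtain c where "u = (\<lambda>x. \<Sum>i\<in>I. c i * \<phi> i x)"
    by (auto simp: fe_span_def)
  then show "fscale r u \<in> fe_span \<phi> I"
    by (auto simp: fe_span_def fun_eq_iff sum_distrib_left algebra_simps
        intro!: exI[of _ "\<lambda>i. r * c i"])
qed

lemma fe_span_subset_span: "fe_span \<phi> I \<subseteq> fun_space.span (\<phi> ` I)"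
proof
  fix v assume "v \<in> fe_span \<phi> I"
  then obtain c where "v = (\<Sum>i\<in>I. fscale (c i) (\<phi> i))"
    by (auto simp: fe_span_def fun_eq_iff sum_fun_apply)
  then show "v \<in> fun_space.span (\<phi> ` I)"
    by (auto intro!: fun_space.span_sum fun_space.span_scale intro: fun_space.span_base)
qed

lemma fe_span_mono:
  assumes "J \<subseteq> I" "finite I"
  shows "fe_span \<phi> J \<subseteq> fe_span \<phi> I"
proof
  fix v assume "v \<in> fe_span \<phi> J"
  then obtain c where v: "v = (\<lambda>x. \<Sum>i\<in>J. c i * \<phi> i x)" by (auto simp: fe_span_def)
  \<comment> \<open>Coefficients are extended by zero to the larger index set.\<close>
  have "v x = (\<Sum>i\<in>I. (if i \<in> J then c i else 0) * \<phi> i x)" for x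
    unfolding v using assms by (intro sum.mono_neutral_cong_left) auto
  then show "v \<in> fe_span \<phi> I"
    by (auto simp: fe_span_def fun_eq_iff intro!: exI[of _ "\<lambda>i. if i \<in> J then c i else 0"])
qed

text \<open>The sum over a disjoint union of index sets splits in two; this provides the
  decomposition of \<open>Vh\<close> into its interior and boundary parts.\<close>

lemma fe_span_Un_split:
  assumes "v \<in> fe_span \<phi> (I \<union> J)" "finite I" "finite J" "I \<inter> J = {}"
  obtains v0 v1 where "v0 \<in> fe_span \<phi> I" "v1 \<in> fe_span \<phi> J" "v = v0 + v1"
proof -
  obtain c where "v = (\<lambda>x. \<Sum>i\<in>I \<union> J. c i * \<phi> i x)"
    using assms(1) by (auto simp: fe_span_def)
  then have "v = (\<lambda>x. \<Sum>i\<in>I. c i * \<phi> i x) + (\<lambda>x. \<Sum>i\<in>J. c i * \<phi> i x)"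
    using assms by (simp add: fun_eq_iff sum.union_disjoint)
  then show ?thesis by (intro that) (auto simp: fe_span_def)
qed

section \<open>Spectra of real operators\<close>

lemma subspace_complexification:
  assumes "fun_space.subspace V"
  shows "fun_space.subspace (complexification V)"
proof (rule fun_space.subspaceI)
  show "0 \<in> complexification V"
    using fun_space.subspace_0[OF assms] by (simp add: complexification_def zero_fun_def)
next
  fix f g assume "f \<in> complexification V" "g \<in> complexification V"
  then show "f + g \<in> complexification V"
    using fun_space.subspace_add[OF assms, of "\<lambda>x. Re (f x)" "\<lambda>x. Re (g x)"]
      fun_space.subspace_add[OF assms, of "\<lambda>x. Im (f x)" "\<lambda>x. Im (g x)"]
    by (simp add: complexification_def plus_fun_def)
next
  fix c f assume "f \<in> complexification V"
  then have "fscale r (\<lambda>x. Re (f x)) \<in> V" "fscale r (\<lambda>x. Im (f x)) \<in> V" for r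
    using fun_space.subspace_scale[OF assms] by (auto simp: complexification_def)
  \<comment> \<open>The two memberships are those of \<open>Re c * Re f - Im c * Im f\<close> and
    \<open>Re c * Im f + Im c * Re f\<close>, the real and imaginary parts of the product.\<close>
  from fun_space.subspace_diff[OF assms this(1)[of "Re c"] this(2)[of "Im c"]]
    fun_space.subspace_add[OF assms this(2)[of "Re c"] this(1)[of "Im c"]]
  show "fscale c f \<in> complexification V"
    by (simp add: complexification_def fscale_def plus_fun_def fun_diff_def)
qed

text \<open>Since \<open>f\<close> is \<open>Re f\<close> plus \<i> times \<open>Im f\<close>, the
  real generators, read as complex-valued functions, also generate the complexification over the
  complex field. Finite dimension thus carries over.\<close>

lemma complexification_subset_span:
  assumes "V \<subseteq> fun_space.span S"
  shows "complexification V \<subseteq> fun_space.span ((\<lambda>v x. complex_of_real (v x)) ` S)"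
proof
  let ?S = "(\<lambda>v x. complex_of_real (v x)) ` S"
  have real: "(\<lambda>x. complex_of_real (v x)) \<in> fun_space.span ?S" if "v \<in> V" for v
  proof -
    have "v \<in> fun_space.span S" using assms that by blast
    then show ?thesis
    proof (induction rule: fun_space.span_induct_alt)
      case base
      then show ?case using fun_space.span_zero[of ?S] by (simp add: zero_fun_def del: fscale_apply)
    next
      case (step c s v)
      have "(\<lambda>x. complex_of_real ((fscale c s + v) x))
          = fscale (complex_of_real c) (\<lambda>x. complex_of_real (s x)) + (\<lambda>x. complex_of_real (v x))"
        by (simp add: fun_eq_iff)
      also have "\<dots> \<in> fun_space.span ?S"
        using step by (intro fun_space.span_add fun_space.span_scale)
          (blast intro: fun_space.span_base)+
      finally show ?case .
    qed
  qed
  fix f assume f: "f \<in> complexification V"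
  have "f = (\<lambda>x. complex_of_real (Re (f x))) + fscale \<i> (\<lambda>x. complex_of_real (Im (f x)))"
    by (simp add: fun_eq_iff complex_eq[symmetric])
  also have "\<dots> \<in> fun_space.span ?S"
    using f by (intro fun_space.span_add fun_space.span_scale real) (auto simp: complexification_def)
  finally show "f \<in> fun_space.span ?S" .
qed

text \<open>Here \<open>p\<close> and \<open>q\<close> are the real and imaginary part of an eigenvector.\<close>

lemma op_spectrum_eigenvector:
  fixes V :: "('a \<Rightarrow> real) set"
  assumes V: "fun_space.subspace V" "V \<subseteq> fun_space.span S" "finite S"
    and maps: "\<And>u. u \<in> V \<Longrightarrow> L u \<in> V"
    and add: "\<And>u v. u \<in> V \<Longrightarrow> v \<in> V \<Longrightarrow> L (u + v) = L u + L v"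
    and scale: "\<And>c u. u \<in> V \<Longrightarrow> L (fscale c u) = fscale c (L u)"
    and z: "z \<in> op_spectrum V L"
  obtains p q where "p \<in> V" "q \<in> V" "p \<noteq> 0 \<or> q \<noteq> 0"
    "L p = fscale (Re z) p - fscale (Im z) q" "L q = fscale (Im z) p + fscale (Re z) q"
proof -
  define G where "G f = (\<lambda>x. z * f x - complexify_op L f x)" for f
  let ?W = "complexification V"
  have Re_Im: "(\<lambda>x. Re (f x)) \<in> V" "(\<lambda>x. Im (f x)) \<in> V" if "f \<in> ?W" for f
    using that by (auto simp: complexification_def)
  have Lf: "complexify_op L f \<in> ?W" if "f \<in> ?W" for f
    using Re_Im[OF that] maps by (simp add: complexification_def complexify_op_def)
  have comb: "L (fscale r u + fscale s v) = fscale r (L u) + fscale s (L v)"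
    if "u \<in> V" "v \<in> V" for r s u v
    using that V(1) by (simp add: add scale fun_space.subspace_scale)
  have G_eq: "G f = fscale z f - complexify_op L f" for f
    by (simp add: G_def fun_eq_iff)
  have "\<not> bij_betw G ?W ?W"
    using z by (simp add: op_spectrum_def G_def[abs_def])
  \<comment> \<open>With trivial kernel, finite dimension would make \<open>G\<close> bijective on
    the complexification. As \<open>z\<close> lies in the spectrum, \<open>G\<close> must have a
    nonzero kernel vector, which is an eigenvector for \<open>z\<close>.\<close>
  moreover have "bij_betw G ?W ?W" if "\<And>f. f \<in> ?W \<Longrightarrow> G f = 0 \<Longrightarrow> f = 0"
  proof (rule fun_space.linear_inj_on_imp_surj[OF subspace_complexification[OF V(1)]
        complexification_subset_span[OF V(2)] _ _ _ _ that])
    fix f assume "f \<in> ?W"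
    then show "G f \<in> ?W"
      unfolding G_eq using subspace_complexification[OF V(1)] Lf
      by (intro fun_space.subspace_diff fun_space.subspace_scale)
  next
    fix f g assume fg: "f \<in> ?W" "g \<in> ?W"
    show "G (f + g) = G f + G g"
      using add[OF Re_Im(1)[OF fg(1)] Re_Im(1)[OF fg(2)]] add[OF Re_Im(2)[OF fg(1)] Re_Im(2)[OF fg(2)]]
      by (simp add: G_def complexify_op_def fun_eq_iff plus_fun_def algebra_simps complex_eq_iff)
  next
    fix c f assume f: "f \<in> ?W"
    \<comment> \<open>Complex homogeneity reduces to real linearity of \<open>L\<close> on the real
      and imaginary parts of the scaled function.\<close>
    have "L (\<lambda>x. Re (fscale c f x)) = fscale (Re c) (L (\<lambda>x. Re (f x))) + fscale (- Im c) (L (\<lambda>x. Im (f x)))"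
      using comb[OF Re_Im[OF f], of "Re c" "- Im c"] by (simp add: plus_fun_def)
    moreover have "L (\<lambda>x. Im (fscale c f x)) = fscale (Im c) (L (\<lambda>x. Re (f x))) + fscale (Re c) (L (\<lambda>x. Im (f x)))"
      using comb[OF Re_Im[OF f], of "Im c" "Re c"] by (simp add: plus_fun_def add.commute)
    ultimately show "G (fscale c f) = fscale c (G f)"
      unfolding G_def complexify_op_def by (simp add: fun_eq_iff algebra_simps complex_eq_iff)
  qed (use V(3) in auto)
  ultimately obtain f where f: "f \<in> ?W" "G f = 0" "f \<noteq> 0" by blast
  have *: "Complex (L (\<lambda>y. Re (f y)) x) (L (\<lambda>y. Im (f y)) x) = z * f x" for x
    using fun_cong[OF f(2), of x] by (simp add: G_def complexify_op_def)
  show thesis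
  proof (rule that[OF Re_Im[OF f(1)]])
    show "(\<lambda>x. Re (f x)) \<noteq> 0 \<or> (\<lambda>x. Im (f x)) \<noteq> 0"
      using f(3) by (auto simp: fun_eq_iff complex_eq_iff)
    show "L (\<lambda>x. Re (f x)) = fscale (Re z) (\<lambda>x. Re (f x)) - fscale (Im z) (\<lambda>x. Im (f x))"
      using arg_cong[OF *, of Re] by (simp add: fun_eq_iff)
    show "L (\<lambda>x. Im (f x)) = fscale (Im z) (\<lambda>x. Re (f x)) + fscale (Re z) (\<lambda>x. Im (f x))"
      using arg_cong[OF *, of Im] by (simp add: fun_eq_iff algebra_simps)
  qed
qed

section \<open>Additive subspace correction\<close>

text \<open>All laws are restricted to \<open>V\<close>, because the integrals that will serve as
  \<open>b\<close> are under control only on the finite element spaces.\<close>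

locale inner_product_on = vector_space scale
  for scale :: "real \<Rightarrow> 'v::ab_group_add \<Rightarrow> 'v" +
  fixes V :: "'v set" and b :: "'v \<Rightarrow> 'v \<Rightarrow> real"
  assumes subspace: "subspace V"
    and add_left: "\<And>u v w. u \<in> V \<Longrightarrow> v \<in> V \<Longrightarrow> w \<in> V \<Longrightarrow> b (u + v) w = b u w + b v w"
    and scale_left: "\<And>c u w. u \<in> V \<Longrightarrow> w \<in> V \<Longrightarrow> b (scale c u) w = c * b u w"
    and sym: "\<And>u v. u \<in> V \<Longrightarrow> v \<in> V \<Longrightarrow> b u v = b v u"
    and pos: "\<And>u. u \<in> V \<Longrightarrow> u \<noteq> 0 \<Longrightarrow> b u u > 0"
begin

lemmas closed = subspace_add[OF subspace] subspace_scale[OF subspace] subspace_diff[OF subspace]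
  subspace_0[OF subspace]

lemma add_right: "u \<in> V \<Longrightarrow> v \<in> V \<Longrightarrow> w \<in> V \<Longrightarrow> b w (u + v) = b w u + b w v"
  by (simp add: sym[of w] closed add_left)

lemma scale_right: "u \<in> V \<Longrightarrow> w \<in> V \<Longrightarrow> b w (scale c u) = c * b w u"
  by (simp add: sym[of w] closed scale_left)

lemma diff_left: "u \<in> V \<Longrightarrow> v \<in> V \<Longrightarrow> w \<in> V \<Longrightarrow> b (u - v) w = b u w - b v w"
  using add_left[of "u - v" v w] by (simp add: closed)

lemma diff_right: "u \<in> V \<Longrightarrow> v \<in> V \<Longrightarrow> w \<in> V \<Longrightarrow> b w (u - v) = b w u - b w v"
  by (simp add: sym[of w] closed diff_left)

lemmas bilinear = add_left add_right scale_left scale_right diff_left diff_right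

lemma zero_left: "w \<in> V \<Longrightarrow> b 0 w = 0"
  using diff_left[of w w w] by simp

lemma nonneg: "u \<in> V \<Longrightarrow> b u u \<ge> 0"
  using pos[of u] zero_left[of 0] closed by (cases "u = 0") auto

text \<open>Test with \<open>w = u - v\<close> and use definiteness.\<close>

lemma eqI:
  assumes "u \<in> V" "v \<in> V" "\<And>w. w \<in> V \<Longrightarrow> b u w = b v w"
  shows "u = v"
  using pos[of "u - v"] diff_left[of u v "u - v"] assms closed by (cases "u = v") auto

text \<open>The parallelogram identity with the nonnegative term \<open>b (u - v) (u - v)\<close>
  dropped. Its factor 2 is the one in the upper eigenvalue bound.\<close>

lemma norm_add_le: "u \<in> V \<Longrightarrow> v \<in> V \<Longrightarrow> b (u + v) (u + v) \<le> 2 * (b u u + b v v)"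
  using nonneg[of "u - v"] by (simp add: closed bilinear)

text \<open>Expand the square of \<open>scale s u - v\<close> and divide by \<open>s\<close>. The
  weight \<open>s\<close> stays free so that the lower eigenvalue bound can tune it.\<close>

lemma young:
  assumes "s > 0" "u \<in> V" "v \<in> V"
  shows "2 * b u v \<le> s * b u u + b v v / s"
proof -
  have "0 \<le> b (scale s u - v) (scale s u - v)"
    using assms by (intro nonneg closed)
  also have "\<dots> = s\<^sup>2 * b u u - 2 * s * b u v + b v v"
    using assms by (simp add: closed bilinear sym[of v u] power2_eq_square algebra_simps)
  finally show ?thesis using assms(1) by (simp add: field_simps power2_eq_square)
qed

end

text \<open>\<open>T u\<close> is the Riesz representative in \<open>(W, b)\<close> of the
  functional \<open>a u\<close> restricted to \<open>W\<close>. For \<open>b = a\<close> this would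
  be the \<open>a\<close>-orthogonal projection onto \<open>W\<close>; a general \<open>b\<close>
  models an inexact subspace solve.\<close>

locale subspace_solver =
  a: inner_product_on scale V a + b: inner_product_on scale W b
  for scale :: "real \<Rightarrow> 'v::ab_group_add \<Rightarrow> 'v" and V a W b +
  fixes T :: "'v \<Rightarrow> 'v"
  assumes W_subset: "W \<subseteq> V"
    and T_in: "\<And>u. u \<in> V \<Longrightarrow> T u \<in> W"
    and T_eq: "\<And>u v. u \<in> V \<Longrightarrow> v \<in> W \<Longrightarrow> b (T u) v = a u v"
begin

lemma T_in_V: "u \<in> V \<Longrightarrow> T u \<in> V"
  using T_in W_subset by blast

text \<open>Linearity of \<open>T\<close> comes from uniqueness of the Riesz representative: both
  sides have the same \<open>b\<close>-products with all of \<open>W\<close>.\<close>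

lemma T_add: "u \<in> V \<Longrightarrow> v \<in> V \<Longrightarrow> T (u + v) = T u + T v"
  using W_subset by (intro b.eqI) (auto simp: T_in T_eq a.closed b.closed b.bilinear a.bilinear)

lemma T_scale: "u \<in> V \<Longrightarrow> T (scale c u) = scale c (T u)"
  using W_subset by (intro b.eqI) (auto simp: T_in T_eq a.closed b.closed b.bilinear a.bilinear)

text \<open>Both sides equal \<open>b (T u) (T v)\<close>, by the defining equation of
  \<open>T\<close> and the symmetry of \<open>a\<close> and \<open>b\<close>.\<close>

lemma T_symmetric: "u \<in> V \<Longrightarrow> v \<in> V \<Longrightarrow> a (T u) v = a u (T v)"
  using T_eq[of v "T u"] T_eq[of u "T v"] b.sym a.sym T_in T_in_V by metis

end

locale additive_schwarz =
  s0: subspace_solver scale V a V0 b0 T0 + s1: subspace_solver scale V a V1 b1 T1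
  for scale :: "real \<Rightarrow> 'v::ab_group_add \<Rightarrow> 'v" and V a V0 b0 T0 V1 b1 T1
begin

definition T :: "'v \<Rightarrow> 'v" where "T u = T0 u + T1 u"

lemma T_in: "u \<in> V \<Longrightarrow> T u \<in> V"
  by (simp add: T_def s0.T_in_V s1.T_in_V s0.a.closed)

lemma T_add: "u \<in> V \<Longrightarrow> v \<in> V \<Longrightarrow> T (u + v) = T u + T v"
  by (simp add: T_def s0.T_add s1.T_add algebra_simps)

lemma T_scale: "u \<in> V \<Longrightarrow> T (scale c u) = scale c (T u)"
  by (simp add: T_def s0.T_scale s1.T_scale s0.a.scale_right_distrib)

lemma T_symmetric: "u \<in> V \<Longrightarrow> v \<in> V \<Longrightarrow> a (T u) v = a u (T v)"
  by (simp add: T_def s0.T_in_V s1.T_in_V s0.a.bilinear s0.T_symmetric s1.T_symmetric)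

text \<open>By symmetry \<open>a (T0 u) u = a u (T0 u)\<close>, and the defining equation with test
  vector \<open>T0 u\<close> turns this into \<open>b0 (T0 u) (T0 u)\<close>; likewise for
  \<open>T1\<close>.\<close>

lemma energy: "u \<in> V \<Longrightarrow> a (T u) u = b0 (T0 u) (T0 u) + b1 (T1 u) (T1 u)"
  by (simp add: T_def s0.T_in s1.T_in s0.T_in_V s1.T_in_V s0.T_eq s1.T_eq s0.a.bilinear
      s0.T_symmetric s1.T_symmetric)

text \<open>Comparing \<open>a (T p) q\<close> with \<open>a p (T q)\<close>, the \<alpha> terms
  cancel and \<open>\<beta> * (a p p + a q q) = 0\<close> remains. Working with real and imaginary
  parts avoids a Hermitian extension of \<open>a\<close>.\<close>

lemma eigenvalue_imag_zero:
  assumes "p \<in> V" "q \<in> V" "p \<noteq> 0 \<or> q \<noteq> 0"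
    and "T p = scale \<alpha> p - scale \<beta> q" "T q = scale \<beta> p + scale \<alpha> q"
  shows "\<beta> = 0"
proof -
  have "a (T p) q = a p (T q)" using assms T_symmetric by blast
  then have "\<beta> * (a p p + a q q) = 0"
    using assms by (simp add: s0.a.closed s0.a.bilinear algebra_simps)
  moreover have "a p p + a q q > 0"
    using assms s0.a.pos s0.a.nonneg by (meson add_nonneg_pos add_pos_nonneg)
  ultimately show ?thesis by simp
qed

lemma eigenvalue_upper:
  assumes u: "u \<in> V" "u \<noteq> 0" "T u = scale \<mu> u"
    and \<rho>: "\<rho> > 0" "\<And>v. v \<in> V0 \<Longrightarrow> a v v \<le> \<rho> * b0 v v" "\<And>v. v \<in> V1 \<Longrightarrow> a v v \<le> \<rho> * b1 v v"
  shows "\<mu> \<le> 2 * \<rho>"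
proof (cases "\<mu> > 0")
  \<comment> \<open>The chain of estimates ends by cancelling \<open>\<mu> * a u u\<close>, which is
    positive in this case; otherwise the claim is immediate from \<open>\<rho> > 0\<close>.\<close>
  case True
  have "a (T u) (T u) \<le> 2 * (a (T0 u) (T0 u) + a (T1 u) (T1 u))"
    unfolding T_def using u by (intro s0.a.norm_add_le s0.T_in_V s1.T_in_V)
  also have "\<dots> \<le> 2 * (\<rho> * b0 (T0 u) (T0 u) + \<rho> * b1 (T1 u) (T1 u))"
    using \<rho> s0.T_in[OF u(1)] s1.T_in[OF u(1)] by (intro mult_left_mono add_mono) auto
  also have "\<dots> = 2 * \<rho> * a (T u) u"
    using energy[OF u(1)] by (simp add: algebra_simps)
  finally have "\<mu> * (\<mu> * a u u) \<le> 2 * \<rho> * (\<mu> * a u u)"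
    using u by (simp add: s0.a.closed s0.a.bilinear)
  moreover have "\<mu> * a u u > 0" using True s0.a.pos u by simp
  ultimately show ?thesis by (meson mult_le_cancel_right_pos)
qed (use \<rho> in auto)

lemma eigenvalue_lower:
  assumes u: "u \<in> V" "u \<noteq> 0" "T u = scale \<mu> u"
    and split: "v0 \<in> V0" "v1 \<in> V1" "u = v0 + v1"
    and K: "a v0 v0 + a v1 v1 \<le> K * a u u"
    and \<gamma>: "\<gamma> > 0" "\<gamma> * b0 v0 v0 \<le> a v0 v0" "\<gamma> * b1 v1 v1 \<le> a v1 v1"
  shows "\<gamma> / K \<le> \<mu>"
proof -
  have auu: "a u u > 0" using s0.a.pos u by blast
  have V: "v0 \<in> V" "v1 \<in> V" using split s0.W_subset s1.W_subset by auto
  \<comment> \<open>Positivity of \<open>K\<close>, on which the later divisions rest, is extracted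
    from the splitting estimate for the nonzero vector \<open>u\<close>.\<close>
  have "v0 \<noteq> 0 \<or> v1 \<noteq> 0" using u split by auto
  then have "0 < a v0 v0 + a v1 v1"
    using s0.a.pos s0.a.nonneg V by (meson add_nonneg_pos add_pos_nonneg)
  with K have "0 < K * a u u" by linarith
  then have "K > 0" using auu by (simp add: zero_less_mult_iff)
  \<comment> \<open>With this weight in Young's inequality the terms in \<open>v0\<close> and
    \<open>v1\<close> sum to at most \<open>a u u\<close>. One of the two copies of
    \<open>a u u\<close> on the left then remains to be compared with
    \<open>s * \<mu> * a u u\<close>.\<close>
  define s where "s = K / \<gamma>"
  have s: "s > 0" using \<open>K > 0\<close> \<gamma> by (simp add: s_def)
  have "2 * a u u = 2 * b0 (T0 u) v0 + 2 * b1 (T1 u) v1"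
    using u V split s0.T_eq[OF u(1) split(1)] s1.T_eq[OF u(1) split(2)]
      s0.a.add_right[OF V u(1)] by simp
  also have "\<dots> \<le> (s * b0 (T0 u) (T0 u) + b0 v0 v0 / s) + (s * b1 (T1 u) (T1 u) + b1 v1 v1 / s)"
    using s u split by (intro add_mono s0.b.young s1.b.young s0.T_in s1.T_in)
  also have "\<dots> = s * (\<mu> * a u u) + (b0 v0 v0 + b1 v1 v1) / s"
    using u energy[OF u(1)] by (simp add: s0.a.bilinear algebra_simps add_divide_distrib)
  also have "(b0 v0 v0 + b1 v1 v1) / s \<le> a u u"
  proof -
    have "\<gamma> * (b0 v0 v0 + b1 v1 v1) \<le> K * a u u"
      using \<gamma> K by (simp add: algebra_simps)
    then show ?thesis using \<open>K > 0\<close> \<gamma> by (simp add: s_def field_simps)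
  qed
  finally have "1 * a u u \<le> (s * \<mu>) * a u u" by (simp add: algebra_simps)
  then have "1 \<le> s * \<mu>" using auu mult_le_cancel_right_pos by blast
  then show ?thesis using \<open>K > 0\<close> \<gamma> by (simp add: s_def field_simps)
qed

end

section \<open>Forms and operators on the finite element space\<close>

text \<open>Integrability holds for \<open>lborel\<close> and passes to its completion. Additivity
  of \<open>l2_inner\<close> rests on this.\<close>

lemma integrable_mult_continuous_on_compact:
  fixes u v :: "'a::euclidean_space \<Rightarrow> real"
  assumes "compact D" "continuous_on D u" "continuous_on D v"
  shows "set_integrable lebesgue D (\<lambda>x. u x * v x)"
proof -
  have "integrable lborel (\<lambda>x. indicator D x *\<^sub>R (u x * v x))"
    using assms by (intro borel_integrable_compact continuous_intros)
  then show ?thesis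
    unfolding set_integrable_def by (subst integrable_completion) auto
qed

lemma l2_inner_sym: "l2_inner D u v = l2_inner D v u"
  by (simp add: l2_inner_def mult.commute)

lemma l2_inner_scale_left: "l2_inner D (fscale c u) v = c * l2_inner D u v"
  by (simp add: l2_inner_def mult.assoc)

lemma l2_inner_add_left:
  assumes "compact D" "continuous_on D u" "continuous_on D v" "continuous_on D w"
  shows "l2_inner D (u + v) w = l2_inner D u w + l2_inner D v w"
  using assms by (simp add: l2_inner_def distrib_right set_integral_add
      integrable_mult_continuous_on_compact)

text \<open>Linearity is read off from the representing operator instead of the formula for the
  form: by symmetry \<open>a v u = l2_inner D v (A u)\<close>, which is linear in \<open>v\<close>.
  No integrability of gradients, traces or jumps has to be examined.\<close>

lemma inner_product_on_represented_form:
  assumes "compact D" "fun_space.subspace V" "\<And>u. u \<in> V \<Longrightarrow> continuous_on D u"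
    and "spd_form V a" "represents_form D V a A"
  shows "inner_product_on fscale V a"
proof
  have sym: "a u v = a v u" if "u \<in> V" "v \<in> V" for u v
    using assms(4) that by (auto simp: spd_form_def)
  have rep: "A u \<in> V" "a v u = l2_inner D v (A u)" if "u \<in> V" "v \<in> V" for u v
    using assms(5) that sym by (auto simp: represents_form_def l2_inner_sym)
  fix c u v w assume V: "u \<in> V" "v \<in> V" "w \<in> V"
  show "a (u + v) w = a u w + a v w"
    using V assms(1-3) rep by (simp add: fun_space.subspace_add l2_inner_add_left)
  show "a (fscale c u) w = c * a u w"
    using V assms(2) rep by (simp add: fun_space.subspace_scale l2_inner_scale_left)
qed (use assms in \<open>auto simp: spd_form_def zero_fun_def\<close>)

lemma spd_operator_linear:
  assumes "fun_space.subspace W" "spd_operator D W B" "u \<in> W" "v \<in> W"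
  shows "B (u + v) = B u + B v" "B (fscale c u) = fscale c (B u)"
proof -
  have *: "B (\<lambda>x. c * u x + d * v x) = (\<lambda>x. c * B u x + d * B v x)" for c d
    using assms by (simp add: spd_operator_def)
  show "B (u + v) = B u + B v" using *[of 1 1] by (simp add: plus_fun_def)
  show "B (fscale c u) = fscale c (B u)" using *[of c 0] by (simp add: fscale_def)
qed

text \<open>Additivity uses that \<open>B\<close> maps \<open>W\<close> into itself, so that
  \<open>B u\<close> and \<open>B v\<close> are again continuous on \<open>D\<close>; symmetry and
  definiteness are part of \<open>spd_operator\<close>.\<close>

lemma inner_product_on_spd_operator:
  assumes "compact D" "fun_space.subspace W" "\<And>u. u \<in> W \<Longrightarrow> continuous_on D u"
    and B: "spd_operator D W B"
  shows "inner_product_on fscale W (\<lambda>u v. l2_inner D (B u) v)"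
proof
  fix c u v w assume W: "u \<in> W" "v \<in> W" "w \<in> W"
  have "B u \<in> W" "B v \<in> W" using B W by (auto simp: spd_operator_def)
  then show "l2_inner D (B (u + v)) w = l2_inner D (B u) w + l2_inner D (B v) w"
    using W assms by (simp add: spd_operator_linear[OF assms(2) B] l2_inner_add_left)
  show "l2_inner D (B (fscale c u)) w = c * l2_inner D (B u) w"
    using W by (simp add: spd_operator_linear[OF assms(2) B W(1,1)] l2_inner_scale_left)
  show "l2_inner D (B u) v = l2_inner D (B v) u"
    using B W by (simp add: spd_operator_def l2_inner_sym[of D u])
next
  fix u assume "u \<in> W" "u \<noteq> 0"
  then show "0 < l2_inner D (B u) u"
    using B unfolding spd_operator_def zero_fun_def by blast
qed (fact assms(2))

text \<open>\<open>B u = 0\<close> makes the product of \<open>B u\<close> with \<open>u\<close>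
  vanish, so definiteness gives a trivial kernel. Hence \<open>the_inv_into\<close> is a genuine
  inverse on \<open>W\<close>.\<close>

lemma bij_betw_spd_operator:
  assumes "fun_space.subspace W" "W \<subseteq> fun_space.span S" "finite S" and B: "spd_operator D W B"
  shows "bij_betw B W W"
proof (rule fun_space.linear_inj_on_imp_surj[OF assms(1-3)])
  fix u assume "u \<in> W" "B u = 0"
  then show "u = 0"
    using B by (force simp: spd_operator_def zero_fun_def l2_inner_def)
qed (use B spd_operator_linear[OF assms(1) B] in \<open>auto simp: spd_operator_def\<close>)

text \<open>For \<open>v\<close> in \<open>W\<close>, applying \<open>B\<close> to the candidate
  leaves \<open>Q (A u)\<close>, whose product with \<open>v\<close> equals that of
  \<open>A u\<close> because the projection error is orthogonal to \<open>W\<close>; and the latter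
  product is \<open>a u v\<close>.\<close>

lemma subspace_solver_preconditioner:
  assumes D: "compact D" and cont: "\<And>u. u \<in> V \<Longrightarrow> continuous_on D u"
    and V: "fun_space.subspace V"
    and W: "fun_space.subspace W" "W \<subseteq> fun_space.span S" "finite S" "W \<subseteq> V"
    and a: "spd_form V a" and A: "represents_form D V a A"
    and Q: "l2_projection D V W Q" and B: "spd_operator D W B"
  shows "subspace_solver fscale V a W (\<lambda>u v. l2_inner D (B u) v) (\<lambda>u. the_inv_into W B (Q (A u)))"
proof -
  interpret a: inner_product_on fscale V a
    using D V cont a A by (rule inner_product_on_represented_form)
  interpret b: inner_product_on fscale W "\<lambda>u v. l2_inner D (B u) v"
    using W(4) cont by (intro inner_product_on_spd_operator D W B) auto
  have bij: "bij_betw B W W" using W(1-3) B by (rule bij_betw_spd_operator)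
  show ?thesis
  proof
    fix u assume u: "u \<in> V"
    have Au: "A u \<in> V" "\<And>v. v \<in> V \<Longrightarrow> l2_inner D (A u) v = a u v"
      using A u by (auto simp: represents_form_def)
    have QA: "Q (A u) \<in> W" "\<And>v. v \<in> W \<Longrightarrow> l2_inner D (A u - Q (A u)) v = 0"
      using Q Au(1) by (auto simp: l2_projection_def fun_diff_def)
    show "the_inv_into W B (Q (A u)) \<in> W"
      using bij QA(1) by (metis bij_betw_def the_inv_into_into order_refl)
    fix v assume v: "v \<in> W"
    have "B (the_inv_into W B (Q (A u))) = Q (A u)"
      using bij QA(1) by (simp add: f_the_inv_into_f_bij_betw)
    moreover have "l2_inner D ((A u - Q (A u)) + Q (A u)) v
        = l2_inner D (A u - Q (A u)) v + l2_inner D (Q (A u)) v"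
      using Au(1) QA(1) v W(4)
      by (intro l2_inner_add_left D cont fun_space.subspace_diff[OF V]) blast+
    ultimately show "l2_inner D (B (the_inv_into W B (Q (A u)))) v = a u v"
      using QA(2) Au(2) v W(4) by auto
  qed (fact W(4))
qed

theorem theorem4p1:
  fixes \<Omega> \<Omega>s :: "(real^'d) set"
    and n :: "real^'d \<Rightarrow> real^'d"
    and Tstar :: "real \<Rightarrow> (real^'d) set set"
    and Th :: "(real^'d) set set"
    and \<Omega>h :: "(real^'d) set"
    and h \<gamma> \<beta> :: real
    and k N N0 :: nat
    and \<xi> :: "nat \<Rightarrow> real^'d"
    and \<phi> :: "nat \<Rightarrow> real^'d \<Rightarrow> real"
    and Vh :: "(real^'d \<Rightarrow> real) set"
    and V :: "nat \<Rightarrow> (real^'d \<Rightarrow> real) set"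
    and a :: "(real^'d \<Rightarrow> real) \<Rightarrow> (real^'d \<Rightarrow> real) \<Rightarrow> real"
    and A C :: "(real^'d \<Rightarrow> real) \<Rightarrow> real^'d \<Rightarrow> real"
    and Q Al B :: "nat \<Rightarrow> (real^'d \<Rightarrow> real) \<Rightarrow> real^'d \<Rightarrow> real"
    and gam rho :: "nat \<Rightarrow> real"
    and Ka :: real
  assumes dim: "CARD('d) \<in> {2, 3}"
    and \<Omega>: "lipschitz_domain \<Omega>"
    and normal: "outward_normal_field \<Omega> n"
    and \<Omega>s: "polyhedral_domain \<Omega>s" "\<Omega> \<subseteq> \<Omega>s"
    and mesh: "\<And>h. h > 0 \<Longrightarrow> simplicial_triangulation_of \<Omega>s (Tstar h)"
    and regular: "shape_regular Tstar"
    and h: "h > 0"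
    and Th: "Th = active_mesh \<Omega> (Tstar h)"
    and \<Omega>h: "\<Omega>h = \<Union>Th"
    and resolved: "cut_elements \<Omega> Th = {T \<in> Th. T \<inter> frontier \<Omega>h \<noteq> {}}"
    and k: "k \<ge> 1"
    and Vh: "Vh = fe_space k Th"
    and basis: "nodal_basis k Th N \<xi> \<phi>"
    and N0: "N0 \<le> N" "\<And>i. i \<in> {1..N} \<Longrightarrow> \<xi> i \<in> frontier \<Omega>h \<longleftrightarrow> i > N0"
    and V0: "V 0 = fe_span \<phi> {1..N0}"
    and V1: "V 1 = fe_span \<phi> {N0 + 1..N}"
    and params: "\<gamma> > 0" "\<beta> > 0"
    and a: "a = cut_form k \<gamma> \<beta> \<Omega> n Th"
    and spd: "spd_form Vh a"
    and Q: "\<And>l. l \<in> {0, 1} \<Longrightarrow> l2_projection \<Omega>h Vh (V l) (Q l)"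
    and A: "represents_form \<Omega>h Vh a A"
    and Al: "\<And>l. l \<in> {0, 1} \<Longrightarrow> represents_form \<Omega>h (V l) a (Al l)"
    and B: "\<And>l. l \<in> {0, 1} \<Longrightarrow> spd_operator \<Omega>h (V l) (B l)"
    and C: "C = (\<lambda>u x. the_inv_into (V 0) (B 0) (Q 0 u) x + the_inv_into (V 1) (B 1) (Q 1 u) x)"
    and pos: "\<And>l. l \<in> {0, 1} \<Longrightarrow> gam l > 0 \<and> rho l > 0"
    and equivalence: "\<And>l u. l \<in> {0, 1} \<Longrightarrow> u \<in> V l \<Longrightarrow>
           gam l * l2_inner \<Omega>h (B l u) u \<le> l2_inner \<Omega>h (Al l u) u \<and>
           l2_inner \<Omega>h (Al l u) u \<le> rho l * l2_inner \<Omega>h (B l u) u"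
    and splitting: "\<And>v0 v1. v0 \<in> V 0 \<Longrightarrow> v1 \<in> V 1 \<Longrightarrow>
           (form_norm a v0)\<^sup>2 + (form_norm a v1)\<^sup>2 \<le> Ka * (form_norm a (\<lambda>x. v0 x + v1 x))\<^sup>2"
  shows "op_spectrum Vh (\<lambda>u. C (A u)) \<subseteq>
           complex_of_real ` {(MIN l\<in>{0, 1}. gam l) / Ka .. 2 * (MAX l\<in>{0, 1}. rho l)}"
proof
  fix z assume z: "z \<in> op_spectrum Vh (\<lambda>u. C (A u))"
  have fin_T: "finite Th" and compact_T: "\<And>T. T \<in> Th \<Longrightarrow> compact T"
    using mesh[OF h] unfolding Th active_mesh_def simplicial_triangulation_of_def triangulation_def
    by (auto intro: compact_simplex)
  then have D: "compact \<Omega>h" unfolding \<Omega>h by (intro compact_Union)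
  have cont: "continuous_on \<Omega>h u" if "u \<in> Vh" for u
    using that by (auto simp: Vh fe_space_def \<Omega>h)
  have Vh_span: "Vh = fe_span \<phi> {1..N}"
    using basis by (simp add: nodal_basis_def Vh)
  have sub: "fun_space.subspace Vh" and span: "Vh \<subseteq> fun_space.span (\<phi> ` {1..N})"
    unfolding Vh_span by (rule subspace_fe_span fe_span_subset_span)+
  have V_le: "V l \<subseteq> Vh" if "l \<in> {0, 1}" for l
    using that N0(1) fe_span_mono[of "{1..N0}" "{1..N}" \<phi>] fe_span_mono[of "{N0 + 1..N}" "{1..N}" \<phi>]
    by (auto simp: Vh_span V0 V1[unfolded One_nat_def])
  have V_sub: "fun_space.subspace (V l)" if "l \<in> {0, 1}" for l
    using that V0 V1 subspace_fe_span by auto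
  define b T where "b l u v = l2_inner \<Omega>h (B l u) v"
    and "T l u = the_inv_into (V l) (B l) (Q l (A u))" for l u v
  have solver: "subspace_solver fscale Vh a (V l) (b l) (T l)" if "l \<in> {0, 1}" for l
    unfolding b_def[abs_def] T_def[abs_def]
    using that V_le[OF that] span
    by (intro subspace_solver_preconditioner[where S = "\<phi> ` {1..N}"] D cont sub V_sub spd A Q B) auto
  interpret schwarz: additive_schwarz fscale Vh a "V 0" "b 0" "T 0" "V 1" "b 1" "T 1"
    using solver by (intro additive_schwarz.intro) auto
  have CA: "(\<lambda>u. C (A u)) = schwarz.T"
    by (intro ext) (simp only: C schwarz.T_def T_def plus_fun_apply)
  have nonneg: "a u u \<ge> 0" if "u \<in> V l" "l \<in> {0, 1}" for l u
    using schwarz.s0.a.nonneg V_le that by blast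
  have energy: "gam l * b l u u \<le> a u u" "a u u \<le> rho l * b l u u" "b l u u \<ge> 0"
    if l: "l \<in> {0, 1}" and u: "u \<in> V l" for l u
  proof -
    \<comment> \<open>On \<open>V l\<close> the subspace operator represents \<open>a\<close>, so
      the spectral equivalence becomes a comparison of \<open>a\<close> with
      \<open>b l\<close>.\<close>
    have "l2_inner \<Omega>h (Al l u) u = a u u"
      using Al[OF l] u by (simp add: represents_form_def)
    then show *: "gam l * b l u u \<le> a u u" "a u u \<le> rho l * b l u u"
      using equivalence[OF l u] by (simp_all add: b_def)
    \<comment> \<open>This sign of \<open>b l u u\<close> is what allows \<open>gam l\<close> to be
      lowered to the minimum and \<open>rho l\<close> to be raised to the maximum.\<close>
    have "0 \<le> rho l * b l u u" using nonneg[OF u l] *(2) by linarith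
    then show "b l u u \<ge> 0" using pos[OF l] by (simp add: zero_le_mult_iff)
  qed
  let ?\<gamma> = "MIN l\<in>{0, 1}. gam l" and ?\<rho> = "MAX l\<in>{0, 1}. rho l"
  have gam: "?\<gamma> > 0" and rho: "?\<rho> > 0" using pos by (auto simp: less_max_iff_disj)
  have le_gam: "?\<gamma> * b l u u \<le> a u u" and le_rho: "a u u \<le> ?\<rho> * b l u u"
    if l: "l \<in> {0, 1}" and u: "u \<in> V l" for l u
  proof -
    have "?\<gamma> * b l u u \<le> gam l * b l u u" "rho l * b l u u \<le> ?\<rho> * b l u u"
      using energy(3)[OF l u] l by (auto intro!: mult_right_mono)
    then show "?\<gamma> * b l u u \<le> a u u" "a u u \<le> ?\<rho> * b l u u"
      using energy(1,2)[OF l u] by linarith+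
  qed
  obtain p q where pq: "p \<in> Vh" "q \<in> Vh" "p \<noteq> 0 \<or> q \<noteq> 0"
    "schwarz.T p = fscale (Re z) p - fscale (Im z) q"
    "schwarz.T q = fscale (Im z) p + fscale (Re z) q"
    using op_spectrum_eigenvector[OF sub span _ schwarz.T_in schwarz.T_add schwarz.T_scale z[unfolded CA]]
    by blast
  have Im: "Im z = 0" using pq by (rule schwarz.eigenvalue_imag_zero)
  \<comment> \<open>With vanishing imaginary part the two equations decouple, so whichever of
    \<open>p\<close> and \<open>q\<close> is nonzero is a real eigenvector.\<close>
  obtain u where u: "u \<in> Vh" "u \<noteq> 0" "schwarz.T u = fscale (Re z) u"
    using pq by (auto simp: Im)
  have "{1..N} = {1..N0} \<union> {N0 + 1..N}" using N0(1) by auto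
  with u(1) have "u \<in> fe_span \<phi> ({1..N0} \<union> {N0 + 1..N})" by (simp only: Vh_span)
  then obtain v0 v1 where v: "v0 \<in> V 0" "v1 \<in> V 1" "u = v0 + v1"
    unfolding V0 V1 by (rule fe_span_Un_split) auto
  \<comment> \<open>Squaring undoes the square root in \<open>form_norm\<close> because
    \<open>a w w\<close> is nonnegative on \<open>Vh\<close>.\<close>
  have sq: "(form_norm a w)\<^sup>2 = a w w" if "w \<in> Vh" for w
    using schwarz.s0.a.nonneg[OF that] by (simp add: form_norm_def)
  have "a v0 v0 + a v1 v1 \<le> Ka * a u u"
    using splitting[OF v(1,2)] v V_le[of 0] V_le[of 1] u(1) by (simp add: sq subset_iff plus_fun_def)
  then have lower: "?\<gamma> / Ka \<le> Re z"
    using gam le_gam v by (intro schwarz.eigenvalue_lower[OF u v]) auto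
  have upper: "Re z \<le> 2 * ?\<rho>"
    using rho le_rho by (intro schwarz.eigenvalue_upper[OF u]) auto
  have "z = complex_of_real (Re z)" using Im by (simp add: complex_eq_iff)
  then show "z \<in> complex_of_real ` {?\<gamma> / Ka .. 2 * ?\<rho>}"
    using lower upper by (intro image_eqI[of _ _ "Re z"]) auto
qed

end
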